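(* Every $P_4$-pivot-minor-free graph has linear rank-width at most $3$.
   Context: All graphs are finite, without loops or multiple edges. $P_4$ denotes the path on $4$ vertices. The local complementation at a vertex $u$ of $G$ replaces every edge of the subgraph induced by the neighbours of $u$ with a non-edge, and vice versa; the result is denoted $G*u$. Pivoting an edge $uv$ of $G$ gives $G\wedge uv = G*u*v*u$. A graph $H$ is a pivot-minor of $G$ if $H$ can be obtained from $G$ by a sequence of edge pivots and vertex deletions. A graph is $H$-pivot-minor-free if it has no pivot-minor isomorphic to $H$. For a graph $G$ with adjacency matrix $A_G$ and $X\subseteq V(G)$, let $\mathrm{cutrk}_G(X)$ be the rank over the binary field of the submatrix $A_G[X,V(G)\setminus X]$ with rows $X$ and columns $V(G)\setminus X$. The width of a linear ordering $(x_1,\ldots,x_n)$ of $V(G)$ is $\max_{1\le i\le n}\mathrm{cutrk}_G(\{x_1,\ldots,x_i\})$. The linear rank-width of $G$ is the minimum width over all linear orderings of $V(G)$. *)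

theory Defs
  imports
    "Graph_Theory.Pair_Digraph"
    "Graph_Theory.Digraph_Isomorphism"
    "HOL-Combinatorics.Multiset_Permutations"
    "HOL-Library.Function_Algebras"
    "HOL-Library.Z2"
begin

text \<open>
  Finite simple graphs are the symmetric digraphs described by the locale \<^locale>\<open>pair_graph\<close>:
  an edge $uv$ is represented by the two arcs $(u,v)$ and $(v,u)$.
\<close>

section \<open>Pivot-minors\<close>

definition neighbours :: "'a pair_pre_digraph \<Rightarrow> 'a \<Rightarrow> 'a set" where
  "neighbours G u = {v. (u, v) \<in> parcs G}"

definition local_complement :: "'a pair_pre_digraph \<Rightarrow> 'a \<Rightarrow> 'a pair_pre_digraph" where
  "local_complement G u =
    (let K = {(x, y). x \<in> neighbours G u \<and> y \<in> neighbours G u \<and> x \<noteq> y}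
     in \<lparr> pverts = pverts G, parcs = (parcs G - K) \<union> (K - parcs G) \<rparr>)"

definition pivot :: "'a pair_pre_digraph \<Rightarrow> 'a \<Rightarrow> 'a \<Rightarrow> 'a pair_pre_digraph" where
  "pivot G u v = local_complement (local_complement (local_complement G u) v) u"

text \<open>The counterpart of \<^const>\<open>pre_digraph.del_vert\<close> for pair digraphs.\<close>

definition delete_vertex :: "'a pair_pre_digraph \<Rightarrow> 'a \<Rightarrow> 'a pair_pre_digraph" where
  "delete_vertex G v =
    \<lparr> pverts = pverts G - {v}, parcs = {(x, y) \<in> parcs G. x \<noteq> v \<and> y \<noteq> v} \<rparr>"

lemma with_proj_delete_vertex:
  "with_proj (delete_vertex G v) = pre_digraph.del_vert (with_proj G) v"
  by (auto simp: with_proj_def delete_vertex_def pre_digraph.del_vert_def)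

inductive pivot_minor :: "'a pair_pre_digraph \<Rightarrow> 'a pair_pre_digraph \<Rightarrow> bool"
  for G :: "'a pair_pre_digraph" where
  refl: "pivot_minor G G"
| pivot: "pivot_minor G H \<Longrightarrow> (u, v) \<in> parcs H \<Longrightarrow> pivot_minor G (pivot H u v)"
| delete: "pivot_minor G H \<Longrightarrow> v \<in> pverts H \<Longrightarrow> pivot_minor G (delete_vertex H v)"

text \<open>In \<open>pivot_minor G H\<close>, the second argument \<open>H\<close> is the minor.\<close>

definition pivot_minor_free :: "'b pair_pre_digraph \<Rightarrow> 'a pair_pre_digraph \<Rightarrow> bool" where
  "pivot_minor_free H G \<longleftrightarrow>
    \<not> (\<exists>H'. pivot_minor G H' \<and> digraph_iso (with_proj H') (with_proj H))"

definition path_graph :: "nat \<Rightarrow> nat pair_pre_digraph" where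
  "path_graph n =
    \<lparr> pverts = {..<n}, parcs = {(i, j). i < n \<and> j < n \<and> (j = Suc i \<or> i = Suc j)} \<rparr>"

lemma pair_graph_local_complement:
  assumes "pair_graph G" shows "pair_graph (local_complement G u)"
proof -
  interpret pair_graph G by fact
  let ?K = "{(x, y). x \<in> neighbours G u \<and> y \<in> neighbours G u \<and> x \<noteq> y}"
  let ?A = "(parcs G - ?K) \<union> (?K - parcs G)"
  have A: "parcs (local_complement G u) = ?A" "pverts (local_complement G u) = pverts G"
    by (simp_all add: local_complement_def Let_def)
  have sub: "?A \<subseteq> pverts G \<times> pverts G"
    by (auto simp: neighbours_def dest: in_arcsD1 in_arcsD2)
  have "sym ?A"
    by (auto intro!: symI dest: arcs_symmetric)
  moreover have "finite ?A"
    using finite_subset[OF sub] pair_finite_verts by blast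
  ultimately show ?thesis
    using sub pair_finite_verts no_loops'
    by unfold_locales (auto simp: A symmetric_def neighbours_def dest: in_arcsD1 in_arcsD2)
qed

lemma pair_graph_delete_vertex:
  assumes "pair_graph G" shows "pair_graph (delete_vertex G v)"
proof -
  interpret pair_graph G by fact
  have "finite {(x, y) \<in> parcs G. x \<noteq> v \<and> y \<noteq> v}"
    by (rule finite_subset[OF _ pair_finite_arcs]) auto
  then show ?thesis
    using pair_finite_verts no_loops'
    by unfold_locales
      (auto simp: delete_vertex_def symmetric_def intro!: symI
        dest: in_arcsD1 in_arcsD2 arcs_symmetric)
qed

lemma pair_graph_pivot_minor:
  "pivot_minor G H \<Longrightarrow> pair_graph G \<Longrightarrow> pair_graph H"
  by (induction rule: pivot_minor.induct)
    (auto simp: pivot_def intro: pair_graph_local_complement pair_graph_delete_vertex)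

lemma pair_graph_path_graph: "pair_graph (path_graph n)"
proof -
  have "finite {(i, j). i < n \<and> j < n \<and> (j = Suc i \<or> i = Suc j)}"
    by (rule finite_subset[of _ "{..<n} \<times> {..<n}"]) auto
  then show ?thesis
    by unfold_locales (auto simp: path_graph_def symmetric_def intro!: symI)
qed


section \<open>Linear rank-width\<close>

text \<open>
  A matrix with arbitrary row and column index types is a function of two arguments, and its
  rows are vectors of functions with pointwise operations.
\<close>

global_interpretation fun_vs: vector_space "\<lambda>(c::'k::field) (f::'a \<Rightarrow> 'k) i. c * f i"
  by unfold_locales (auto simp: fun_eq_iff algebra_simps)

definition adjacency_matrix :: "'a pair_pre_digraph \<Rightarrow> 'a \<Rightarrow> 'a \<Rightarrow> bit" where
  "adjacency_matrix G x y = (if (x, y) \<in> parcs G then 1 else 0)"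

text \<open>
  The rank of the submatrix of \<open>A\<close> with rows \<open>X\<close> and columns \<open>Y\<close>, as the dimension of its row
  space. Rows are padded with zeros outside \<open>Y\<close>, which does not affect the dimension.
\<close>

definition submatrix_rank :: "('a \<Rightarrow> 'b \<Rightarrow> 'k::field) \<Rightarrow> 'a set \<Rightarrow> 'b set \<Rightarrow> nat" where
  "submatrix_rank A X Y = fun_vs.dim ((\<lambda>x y. if y \<in> Y then A x y else 0) ` X)"

definition cutrk :: "'a pair_pre_digraph \<Rightarrow> 'a set \<Rightarrow> nat" where
  "cutrk G X = submatrix_rank (adjacency_matrix G) X (pverts G - X)"

text \<open>
  A linear ordering of the vertices is an element of \<open>permutations_of_set (pverts G)\<close>, i.e. a
  list in which every vertex occurs exactly once. Inserting \<open>0\<close> only matters for the empty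
  graph, whose unique ordering gets width \<open>0\<close>.
\<close>

definition ordering_width :: "'a pair_pre_digraph \<Rightarrow> 'a list \<Rightarrow> nat" where
  "ordering_width G xs = Max (insert 0 ((\<lambda>i. cutrk G (set (take i xs))) ` {1..length xs}))"

definition linear_rank_width :: "'a pair_pre_digraph \<Rightarrow> nat" where
  "linear_rank_width G = Min (ordering_width G ` permutations_of_set (pverts G))"

end

(*
  Pivoting turns a 4-cycle into P4, and it turns a vertex u whose neighbourhood contains an induced
  path a-v-b together with a non-adjacent pair c, d anticomplete to this path into a graph with the
  4-cycle a-c-b-d.  Hence the graph contains none of these three.  Excluding P4 and C4, the closed
  neighbourhood of a vertex of maximum degree is a union of components, so every component has a
  dominating vertex u; excluding the third configuration, at most one component left after removing
  u is not a clique.  List u first, then the cliques, then recurse into the remaining component: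
  before each cut, the rows restricted to the vertices still to come are the zero row, the all-one
  row or one further row.
*)

theory Submission
  imports Defs
begin

section \<open>Orderings of P4-free and C4-free relations\<close>

text \<open>A row of the cut matrix over the binary field is encoded by its support. Equal rows
  collapse to one set, so the number of nonempty members bounds the cut-rank.\<close>

definition cut_rows :: "('a \<Rightarrow> 'a \<Rightarrow> bool) \<Rightarrow> 'a set \<Rightarrow> 'a set \<Rightarrow> 'a set set" where
  "cut_rows E X Y = (\<lambda>x. {y \<in> Y. E x y}) ` X"

text \<open>The bound counts distinct nonzero rows, which is stronger than bounding the rank and
  survives concatenation without linear algebra. The zero row \<open>{}\<close> is not
  counted.\<close>

definition ordering_within :: "('a \<Rightarrow> 'a \<Rightarrow> bool) \<Rightarrow> nat \<Rightarrow> 'a list \<Rightarrow> bool" where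
  "ordering_within E k xs \<longleftrightarrow> (\<forall>ps qs. xs = ps @ qs \<longrightarrow>
     (\<exists>\<D>. finite \<D> \<and> card \<D> \<le> k \<and> cut_rows E (set ps) (set qs) \<subseteq> insert {} \<D>))"

text \<open>Of the two nonzero rows allowed, one must be the all-one row \<open>set qs\<close>. This
  is the row of a dominating vertex, so such a vertex can be put in front without a further
  row.\<close>

definition dominated_ordering :: "('a \<Rightarrow> 'a \<Rightarrow> bool) \<Rightarrow> 'a list \<Rightarrow> bool" where
  "dominated_ordering E xs \<longleftrightarrow> (\<forall>ps qs. xs = ps @ qs \<longrightarrow>
     (\<exists>D. cut_rows E (set ps) (set qs) \<subseteq> {{}, set qs, D}))"

definition anticomplete :: "('a \<Rightarrow> 'a \<Rightarrow> bool) \<Rightarrow> 'a set \<Rightarrow> 'a set \<Rightarrow> bool" where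
  "anticomplete E X Y \<longleftrightarrow> (\<forall>x\<in>X. \<forall>y\<in>Y. \<not> E x y)"

section \<open>Cuts of concatenated orderings\<close>

lemma dominated_imp_ordering_within:
  assumes "dominated_ordering E xs"
  shows "ordering_within E 2 xs"
  unfolding ordering_within_def
proof (intro allI impI)
  fix ps qs assume "xs = ps @ qs"
  then obtain D where "cut_rows E (set ps) (set qs) \<subseteq> {{}, set qs, D}"
    using assms unfolding dominated_ordering_def by blast
  then show "\<exists>\<D>. finite \<D> \<and> card \<D> \<le> 2 \<and> cut_rows E (set ps) (set qs) \<subseteq> insert {} \<D>"
    by (intro exI[of _ "{set qs, D}"]) (auto simp: card_insert_if)
qed

lemma cut_rows_Un_right:
  "anticomplete E X Z \<Longrightarrow> cut_rows E X (Y \<union> Z) = cut_rows E X Y"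
  unfolding cut_rows_def anticomplete_def by (intro image_cong) auto

lemma cut_rows_Un_left:
  "anticomplete E X Y \<Longrightarrow> cut_rows E (X \<union> Z) Y \<subseteq> insert {} (cut_rows E Z Y)"
  unfolding cut_rows_def anticomplete_def by auto

text \<open>A cut lies inside one block. The other block adds only zero columns (if it comes later)
  or only zero rows (if it came earlier), so the bound stays \<open>k\<close>.\<close>

lemma ordering_within_append:
  assumes "ordering_within E k xs" "ordering_within E k ys" "anticomplete E (set xs) (set ys)"
  shows "ordering_within E k (xs @ ys)"
  unfolding ordering_within_def
proof (intro allI impI)
  fix ps qs assume "xs @ ys = ps @ qs"
  then consider (left) us where "xs = ps @ us" "qs = us @ ys"
    | (right) us where "ps = xs @ us" "ys = us @ qs"
    by (auto simp: append_eq_append_conv2)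
  then show "\<exists>\<D>. finite \<D> \<and> card \<D> \<le> k \<and> cut_rows E (set ps) (set qs) \<subseteq> insert {} \<D>"
  proof cases
    case left
    then have "cut_rows E (set ps) (set qs) = cut_rows E (set ps) (set us)"
      using assms(3) by (auto simp: anticomplete_def intro!: cut_rows_Un_right)
    then show ?thesis using assms(1) left unfolding ordering_within_def by auto
  next
    case right
    then have "cut_rows E (set ps) (set qs) \<subseteq> insert {} (cut_rows E (set us) (set qs))"
      using assms(3) by (auto simp: anticomplete_def intro!: cut_rows_Un_left)
    moreover obtain \<D> where "finite \<D>" "card \<D> \<le> k"
      "cut_rows E (set us) (set qs) \<subseteq> insert {} \<D>"
      using assms(2) right unfolding ordering_within_def by blast
    ultimately show ?thesis by blast
  qed
qed

lemma clique_ordering_within: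
  assumes "distinct xs" "\<And>x y. x \<in> set xs \<Longrightarrow> y \<in> set xs \<Longrightarrow> x \<noteq> y \<Longrightarrow> E x y"
  shows "ordering_within E (Suc 0) xs"
  unfolding ordering_within_def
proof (intro allI impI)
  fix ps qs assume xs: "xs = ps @ qs"
  have "E x y" if "x \<in> set ps" "y \<in> set qs" for x y
    using assms(1) that by (intro assms(2)) (auto simp: xs)
  then have "cut_rows E (set ps) (set qs) \<subseteq> {set qs}"
    unfolding cut_rows_def by blast
  then show "\<exists>\<D>. finite \<D> \<and> card \<D> \<le> Suc 0 \<and> cut_rows E (set ps) (set qs) \<subseteq> insert {} \<D>"
    by (intro exI[of _ "{set qs}"]) auto
qed

text \<open>The vertex \<open>u\<close> adds the all-one row, the only nonzero row besides those of
  the block being cut. Placing \<open>rs\<close> before \<open>cs\<close> matters: if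
  \<open>rs\<close> came last, the all-one row within \<open>cs\<close> would differ from the row of
  \<open>u\<close>, and three nonzero rows could occur.\<close>

lemma dominated_ordering_Cons:
  assumes u: "\<And>x. x \<in> set rs \<union> set cs \<Longrightarrow> E u x"
    and rs: "ordering_within E (Suc 0) rs" and cs: "dominated_ordering E cs"
    and anti: "anticomplete E (set rs) (set cs)"
  shows "dominated_ordering E (u # rs @ cs)"
  unfolding dominated_ordering_def
proof (intro allI impI)
  fix ps qs assume eq: "u # rs @ cs = ps @ qs"
  show "\<exists>D. cut_rows E (set ps) (set qs) \<subseteq> {{}, set qs, D}"
  proof (cases ps)
    case Nil
    then show ?thesis by (simp add: cut_rows_def)
  next
    case (Cons p ps')
    have [simp]: "p = u" and eq': "rs @ cs = ps' @ qs" using eq Cons by auto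
    have row_u: "{y \<in> set qs. E u y} = set qs"
      using u eq' by (metis (mono_tags, lifting) Collect_cong Collect_mem_eq UnCI set_append)
    have ins: "cut_rows E (set ps) (set qs) = insert (set qs) (cut_rows E (set ps') (set qs))"
      using Cons row_u by (simp add: cut_rows_def)
    from eq' consider (left) us where "rs = ps' @ us" "qs = us @ cs"
      | (right) us where "ps' = rs @ us" "cs = us @ qs"
      by (auto simp: append_eq_append_conv2)
    then show ?thesis
    proof cases
      case left
      \<comment> \<open>With \<open>cs\<close> still to come, the single nonzero row of
        \<open>rs\<close> need not be all-one, so it takes the free place \<open>D\<close>.\<close>
      then have "cut_rows E (set ps') (set qs) = cut_rows E (set ps') (set us)"
        using anti by (auto simp: anticomplete_def intro!: cut_rows_Un_right)
      moreover obtain \<D> where "finite \<D>" "card \<D> \<le> Suc 0"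
        "cut_rows E (set ps') (set us) \<subseteq> insert {} \<D>"
        using rs left unfolding ordering_within_def by blast
      moreover from \<open>finite \<D>\<close> \<open>card \<D> \<le> Suc 0\<close> obtain D where "\<D> \<subseteq> {D}"
        by (cases "\<D> = {}") (auto simp: card_le_Suc0_iff_eq)
      ultimately have "cut_rows E (set ps) (set qs) \<subseteq> {{}, set qs, D}"
        unfolding ins by auto
      then show ?thesis ..
    next
      case right
      then have "cut_rows E (set ps') (set qs) \<subseteq> insert {} (cut_rows E (set us) (set qs))"
        using anti by (auto simp: anticomplete_def intro!: cut_rows_Un_left)
      moreover obtain D where "cut_rows E (set us) (set qs) \<subseteq> {{}, set qs, D}"
        using cs right unfolding dominated_ordering_def by blast
      ultimately have "cut_rows E (set ps) (set qs) \<subseteq> {{}, set qs, D}"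
        unfolding ins by auto
      then show ?thesis ..
    qed
  qed
qed

section \<open>Dominating vertices and recursive orderings\<close>

lemma obtain_max_degree:
  assumes "finite S" "P w"
  obtains v where "P v" "\<And>x. P x \<Longrightarrow> card {y \<in> S. E x y} \<le> card {y \<in> S. E v y}"
proof -
  have "\<forall>x. P x \<longrightarrow> card {y \<in> S. E x y} < Suc (card S)"
    using assms(1) by (auto simp: less_Suc_eq_le intro!: card_mono)
  with assms(2) have "\<exists>v. P v \<and> (\<forall>x. P x \<longrightarrow> card {y \<in> S. E x y} \<le> card {y \<in> S. E v y})"
    by (rule ex_has_greatest_nat)
  then show thesis using that by blast
qed

text \<open>Graphs without induced \<open>P4\<close> and \<open>C4\<close> are the quasi-threshold
  graphs; the last axiom also excludes a cone over a three-vertex path plus two isolated vertices.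
  \<open>no_P4\<close> can omit distinctness, since any coincidence makes its conclusion true; in
  \<open>no_C4\<close> opposite corners must be assumed distinct.\<close>

locale quasi_threshold =
  fixes E :: "'a \<Rightarrow> 'a \<Rightarrow> bool"
  assumes sym: "E x y \<Longrightarrow> E y x"
    and irrefl: "\<not> E x x"
    and no_P4: "E a b \<Longrightarrow> E b c \<Longrightarrow> E c d \<Longrightarrow> E a c \<or> E a d \<or> E b d"
    and no_C4: "E a b \<Longrightarrow> E b c \<Longrightarrow> E c d \<Longrightarrow> E d a \<Longrightarrow> a \<noteq> c \<Longrightarrow> b \<noteq> d \<Longrightarrow> E a c \<or> E b d"
    and no_P3_pair_cone: "\<forall>x\<in>{v, a, b, c, d}. E u x \<Longrightarrow> E v a \<Longrightarrow> E v b \<Longrightarrow> a \<noteq> b \<Longrightarrow> c \<noteq> d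
      \<Longrightarrow> anticomplete E {c, d} {v, a, b} \<Longrightarrow> E a b \<or> E c d"
begin

lemma anticomplete_commute: "anticomplete E X Y \<longleftrightarrow> anticomplete E Y X"
  unfolding anticomplete_def using sym by blast

text \<open>If an edge \<open>x y\<close> leaves the closed neighbourhood of \<open>v\<close>,
  comparing degrees yields a neighbour \<open>z\<close> of \<open>v\<close> not adjacent to
  \<open>x\<close>, and \<open>z\<close>, \<open>v\<close>, \<open>x\<close>, \<open>y\<close>
  induce a \<open>P4\<close> or a \<open>C4\<close>. Maximality is required only against such
  \<open>x\<close>, so that \<open>v\<close> may be maximal within a smaller class of
  vertices.\<close>

lemma closed_nbhd_anticomplete:
  assumes "finite S" "v \<in> S"
    and max: "\<And>x. x \<in> S \<Longrightarrow> E v x \<Longrightarrow> \<exists>y\<in>S. E x y \<and> y \<noteq> v \<and> \<not> E v y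
      \<Longrightarrow> card {y \<in> S. E x y} \<le> card {y \<in> S. E v y}"
  defines "C \<equiv> insert v {x \<in> S. E v x}"
  shows "anticomplete E C (S - C)"
proof (rule ccontr)
  assume "\<not> ?thesis"
  then obtain x y where xy: "x \<in> C" "y \<in> S" "y \<notin> C" "E x y"
    unfolding anticomplete_def by auto
  then have x: "x \<in> S" "E v x" and y: "y \<noteq> v" "\<not> E v y"
    using \<open>v \<in> S\<close> by (auto simp: C_def)
  let ?N = "\<lambda>x. {y \<in> S. E x y}"
  have le: "card (?N x) \<le> card (?N v)"
    using max x xy y by blast
  have "\<exists>z \<in> ?N v. z \<noteq> x \<and> \<not> E x z"
  proof (rule ccontr)
    assume "\<not> ?thesis"
    then have "insert y (insert v (?N v - {x})) \<subseteq> ?N x"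
      using xy x \<open>v \<in> S\<close> sym by blast
    then have "card (insert y (insert v (?N v - {x}))) \<le> card (?N x)"
      using \<open>finite S\<close> by (intro card_mono) auto
    \<comment> \<open>Exchanging \<open>x\<close> for \<open>v\<close> keeps the size and adding
      \<open>y\<close> raises it by one, against the maximality of \<open>v\<close>.\<close>
    moreover have "card (insert y (insert v (?N v - {x}))) = Suc (card (?N v))"
    proof -
      have "Suc (card (?N v - {x})) = card (?N v)"
        using x \<open>finite S\<close> by (intro card_Suc_Diff1) auto
      moreover have "v \<notin> ?N v - {x}" "y \<notin> insert v (?N v - {x})"
        using irrefl y by auto
      ultimately show ?thesis using \<open>finite S\<close> by simp
    qed
    ultimately show False using le by simp
  qed
  then obtain z where "E v z" "z \<noteq> x" "\<not> E x z" by blast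
  \<comment> \<open>\<open>no_P4\<close> forces an edge from \<open>z\<close> to \<open>y\<close>,
    which closes a 4-cycle without chords.\<close>
  then show False
    using no_P4[of z v x y] no_C4[of z v x y] x y xy sym by metis
qed

text \<open>Without an induced path on three vertices, the closed neighbourhood of any vertex is a
  clique with no edge to the rest. Listing these cliques one after another leaves at most one
  nonzero row at each cut.\<close>

lemma ordering_disjoint_cliques:
  assumes "finite R" "\<And>a v b. {a, v, b} \<subseteq> R \<Longrightarrow> E v a \<Longrightarrow> E v b \<Longrightarrow> a \<noteq> b \<Longrightarrow> E a b"
  shows "\<exists>xs. distinct xs \<and> set xs = R \<and> ordering_within E (Suc 0) xs"
  using assms
proof (induction rule: finite_psubset_induct)
  case (psubset R)
  show ?case
  proof (cases "R = {}")
    case True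
    then show ?thesis
      by (intro exI[of _ "[]"]) (auto simp: ordering_within_def cut_rows_def intro: exI[of _ "{}"])
  next
    case False
    then obtain v where v: "v \<in> R" by blast
    define C where "C = insert v {x \<in> R. E v x}"
    have C: "C \<subseteq> R" "v \<in> C" using v by (auto simp: C_def)
    have clique: "E x y" if "x \<in> C" "y \<in> C" "x \<noteq> y" for x y
      using that psubset.prems[of x v y] v sym by (auto simp: C_def)
    have "anticomplete E C (R - C)"
      unfolding C_def anticomplete_def
    proof (intro ballI notI)
      fix x y assume *: "x \<in> insert v {x \<in> R. E v x}" "y \<in> R - insert v {x \<in> R. E v x}" "E x y"
      then show False using psubset.prems[of v x y] v sym by auto
    qed
    moreover obtain cs where "distinct cs" "set cs = C"
      using finite_distinct_list[of C] finite_subset[OF C(1) psubset.hyps] by blast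
    moreover from this have "ordering_within E (Suc 0) cs"
      using clique by (intro clique_ordering_within) auto
    moreover have "R - C \<subset> R" using C by blast
    then have "\<exists>rs. distinct rs \<and> set rs = R - C \<and> ordering_within E (Suc 0) rs"
    proof (rule psubset.IH)
      fix a x b assume "{a, x, b} \<subseteq> R - C" "E x a" "E x b" "a \<noteq> b"
      then show "E a b" using psubset.prems[of a x b] by simp
    qed
    then obtain rs where "distinct rs" "set rs = R - C" "ordering_within E (Suc 0) rs"
      by blast
    ultimately show ?thesis
      using C by (intro exI[of _ "cs @ rs"]) (auto intro: ordering_within_append)
  qed
qed

text \<open>Remove \<open>u\<close>. If the rest \<open>?T\<close> has an induced three-vertex path,
  a suitable midpoint \<open>v\<close> dominates a set \<open>C\<close> without edges to
  \<open>?T - C\<close>; \<open>C\<close> is handled recursively with \<open>v\<close> in the role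
  of \<open>u\<close>. What remains consists of disjoint cliques, listed between \<open>u\<close>
  and \<open>C\<close>.\<close>

lemma dominated_ordering_exists:
  assumes "finite S" "u \<in> S" "\<And>x. x \<in> S \<Longrightarrow> x \<noteq> u \<Longrightarrow> E u x"
  shows "\<exists>xs. distinct xs \<and> set xs = S \<and> dominated_ordering E xs"
  using assms
proof (induction arbitrary: u rule: finite_psubset_induct)
  case (psubset S)
  let ?T = "S - {u}"
  \<comment> \<open>\<open>P\<close> singles out the midpoints of induced three-vertex paths. A
    vertex of maximum degree in all of \<open>?T\<close> might lie in a large clique component and
    give no such path.\<close>
  define P where "P v \<longleftrightarrow> v \<in> ?T \<and> (\<exists>a\<in>?T. \<exists>b\<in>?T. E v a \<and> E v b \<and> a \<noteq> b \<and> \<not> E a b)" for v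
  have "\<exists>C \<subseteq> ?T. anticomplete E (?T - C) C
      \<and> (\<exists>cs. distinct cs \<and> set cs = C \<and> dominated_ordering E cs)
      \<and> (\<forall>a v b. {a, v, b} \<subseteq> ?T - C \<longrightarrow> E v a \<longrightarrow> E v b \<longrightarrow> a \<noteq> b \<longrightarrow> E a b)"
  proof (cases "\<exists>v. P v")
    case False
    then show ?thesis
      by (intro exI[of _ "{}"])
        (auto simp: P_def anticomplete_def dominated_ordering_def cut_rows_def)
  next
    case True
    then obtain w where "P w" by blast
    then obtain v where v: "P v"
      and max: "\<And>x. P x \<Longrightarrow> card {y \<in> ?T. E x y} \<le> card {y \<in> ?T. E v y}"
      using obtain_max_degree[of ?T P w E] psubset.hyps by blast
    from v have vT: "v \<in> ?T" unfolding P_def by blast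
    from v obtain a b where ab: "a \<in> ?T" "b \<in> ?T" "E v a" "E v b" "a \<noteq> b" "\<not> E a b"
      unfolding P_def by blast
    define C where "C = insert v {x \<in> ?T. E v x}"
    have C: "C \<subseteq> ?T" "v \<in> C" "a \<in> C" "b \<in> C" using vT ab by (auto simp: C_def)
    have anti: "anticomplete E C (?T - C)"
      unfolding C_def
    proof (rule closed_nbhd_anticomplete)
      fix x assume "x \<in> ?T" "E v x" "\<exists>y\<in>?T. E x y \<and> y \<noteq> v \<and> \<not> E v y"
      \<comment> \<open>The path from \<open>v\<close> through \<open>x\<close> to the outside
        vertex is induced, so \<open>x\<close> is itself a midpoint and competes with
        \<open>v\<close> for maximum degree.\<close>
      then have "P x" unfolding P_def using vT sym by blast
      then show "card {y \<in> ?T. E x y} \<le> card {y \<in> ?T. E v y}" by (rule max)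
    qed (use psubset.hyps vT in auto)
    then have anti': "anticomplete E (?T - C) C" by (simp add: anticomplete_commute)
    have "C \<subset> S" using C psubset.prems by blast
    then have "\<exists>cs. distinct cs \<and> set cs = C \<and> dominated_ordering E cs"
    proof (rule psubset.IH)
      show "v \<in> C" by (rule C)
    qed (simp add: C_def)
    \<comment> \<open>A non-adjacent pair outside \<open>C\<close>, together with the path
      \<open>a\<close>, \<open>v\<close>, \<open>b\<close> and the apex \<open>u\<close>, is the
      forbidden cone.\<close>
    moreover have clique: "E c d" if "c \<in> ?T - C" "d \<in> ?T - C" "c \<noteq> d" for c d
    proof -
      have "anticomplete E {c, d} {v, a, b}"
        using anti' that C unfolding anticomplete_def by blast
      moreover have "\<forall>x\<in>{v, a, b, c, d}. E u x"
        using psubset.prems vT ab that by auto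
      ultimately show ?thesis
        using no_P3_pair_cone[of v a b c d u] ab that by blast
    qed
    ultimately show ?thesis
      using anti' C(1) by (intro exI[of _ C] conjI allI impI clique) simp_all
  qed
  then obtain C where C: "C \<subseteq> ?T" "anticomplete E (?T - C) C"
    and ex_cs: "\<exists>cs. distinct cs \<and> set cs = C \<and> dominated_ordering E cs"
    and R: "\<forall>a v b. {a, v, b} \<subseteq> ?T - C \<longrightarrow> E v a \<longrightarrow> E v b \<longrightarrow> a \<noteq> b \<longrightarrow> E a b"
    by (rule exE) (elim conjE, rule that)
  from ex_cs obtain cs where cs: "distinct cs" "set cs = C" "dominated_ordering E cs"
    by blast
  have "\<exists>rs. distinct rs \<and> set rs = ?T - C \<and> ordering_within E (Suc 0) rs"
  proof (rule ordering_disjoint_cliques)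
    show "finite (?T - C)" using psubset.hyps by simp
  qed (use R in blast)
  then obtain rs where rs: "distinct rs" "set rs = ?T - C" "ordering_within E (Suc 0) rs"
    by blast
  have "dominated_ordering E (u # rs @ cs)"
  proof (rule dominated_ordering_Cons)
    show "E u x" if "x \<in> set rs \<union> set cs" for x
      using that C(1) psubset.prems(2)[of x] unfolding rs cs by blast
  qed (use C(2) cs rs in simp_all)
  moreover have "distinct (u # rs @ cs)" "set (u # rs @ cs) = S"
    using psubset.prems(1) C(1) cs rs by auto
  ultimately show ?case by blast
qed

text \<open>The closed neighbourhood of a vertex of maximum degree has no edge to the rest and is
  dominated by that vertex. Its dominated ordering is followed by an ordering of the rest.\<close>

lemma ordering_within_2_exists:
  assumes "finite S"
  shows "\<exists>xs. distinct xs \<and> set xs = S \<and> ordering_within E 2 xs"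
  using assms
proof (induction rule: finite_psubset_induct)
  case (psubset S)
  show ?case
  proof (cases "S = {}")
    case True
    then show ?thesis
      by (intro exI[of _ "[]"]) (auto simp: ordering_within_def cut_rows_def intro: exI[of _ "{}"])
  next
    case False
    then obtain w where "w \<in> S" by blast
    then obtain v where v: "v \<in> S"
      and max: "\<And>x. x \<in> S \<Longrightarrow> card {y \<in> S. E x y} \<le> card {y \<in> S. E v y}"
      using obtain_max_degree[of S "\<lambda>x. x \<in> S" w E] psubset.hyps by blast
    define C where "C = insert v {x \<in> S. E v x}"
    have C: "C \<subseteq> S" "v \<in> C" using v by (auto simp: C_def)
    have "anticomplete E C (S - C)"
      unfolding C_def using psubset.hyps v max by (intro closed_nbhd_anticomplete) auto
    moreover have "\<exists>cs. distinct cs \<and> set cs = C \<and> dominated_ordering E cs"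
    proof (rule dominated_ordering_exists)
      show "finite C" "v \<in> C" using C finite_subset psubset.hyps by blast+
    qed (simp add: C_def)
    then obtain cs where "distinct cs" "set cs = C" "ordering_within E 2 cs"
      using dominated_imp_ordering_within by blast
    moreover have "S - C \<subset> S" using C by blast
    then obtain rs where "distinct rs" "set rs = S - C" "ordering_within E 2 rs"
      using psubset.IH by blast
    ultimately show ?thesis
      using C by (intro exI[of _ "cs @ rs"])
        (auto intro: ordering_within_append)
  qed
qed

end

section \<open>Pivot-minors\<close>

lemma pivot_minor_trans:
  assumes "pivot_minor H K" "pivot_minor G H"
  shows "pivot_minor G K"
  using assms
proof (induction rule: pivot_minor.induct)
  case refl
  then show ?case by simp
qed (simp_all add: pivot_minor.pivot pivot_minor.delete)

lemma pivot_minor_pivot: "(u, v) \<in> parcs G \<Longrightarrow> pivot_minor G (pivot G u v)"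
  by (rule pivot_minor.pivot[OF pivot_minor.refl])

lemma pivot_minor_free_trans:
  "pivot_minor_free H G \<Longrightarrow> pivot_minor G K \<Longrightarrow> pivot_minor_free H K"
  unfolding pivot_minor_free_def using pivot_minor_trans by blast

lemma pair_graph_pivot: "pair_graph G \<Longrightarrow> pair_graph (pivot G u v)"
  by (simp add: pivot_def pair_graph_local_complement)

lemma pivot_minor_induced:
  assumes "finite D" "D \<subseteq> pverts G"
  shows "pivot_minor G \<lparr>pverts = pverts G - D, parcs = {(x, y) \<in> parcs G. x \<notin> D \<and> y \<notin> D}\<rparr>"
    (is "pivot_minor G (?del D)")
  using assms
proof (induction rule: finite_induct)
  case empty
  have "?del {} = G" by simp
  then show ?case by (simp only: pivot_minor.refl)
next
  case (insert x D)
  have "delete_vertex (?del D) x = ?del (insert x D)"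
    unfolding delete_vertex_def by auto
  moreover have "x \<in> pverts (?del D)" using insert by auto
  ultimately show ?case using pivot_minor.delete[of G "?del D" x] insert by auto
qed

text \<open>Deleting all vertices outside the image of \<open>f\<close> leaves an isomorphic copy of
  \<open>H\<close>, so an induced copy already contradicts freeness.\<close>

lemma pivot_minor_freeD_embedding:
  assumes G: "pair_graph G" and free: "pivot_minor_free H G" and H: "pair_graph H"
    and f: "inj_on f (pverts H)" "f ` pverts H \<subseteq> pverts G"
    and arcs: "\<And>x y. x \<in> pverts H \<Longrightarrow> y \<in> pverts H \<Longrightarrow> (f x, f y) \<in> parcs G \<longleftrightarrow> (x, y) \<in> parcs H"
  shows False
proof -
  interpret G: pair_graph G by fact
  interpret H: pair_graph H by fact
  let ?D = "pverts G - f ` pverts H"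
  let ?K = "\<lparr>pverts = pverts G - ?D, parcs = {(x, y) \<in> parcs G. x \<notin> ?D \<and> y \<notin> ?D}\<rparr>"
  have "pivot_minor G ?K"
    by (rule pivot_minor_induced) auto
  moreover have parcs_K: "parcs ?K = map_prod f f ` parcs H"
  proof (intro subset_antisym subrelI)
    fix x y assume "(x, y) \<in> parcs ?K"
    then have xy: "(x, y) \<in> parcs G" "x \<in> f ` pverts H" "y \<in> f ` pverts H"
      by (auto dest: G.in_arcsD1 G.in_arcsD2)
    then obtain i j where "i \<in> pverts H" "j \<in> pverts H" "x = f i" "y = f j" by blast
    then show "(x, y) \<in> map_prod f f ` parcs H"
      using xy arcs by (intro image_eqI[of _ _ "(i, j)"]) auto
  next
    fix x y assume "(x, y) \<in> map_prod f f ` parcs H"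
    then show "(x, y) \<in> parcs ?K"
      using arcs by (auto dest: H.in_arcsD1 H.in_arcsD2)
  qed
  moreover have "pverts ?K = f ` pverts H" using f(2) by auto
  ultimately have minor: "pivot_minor G ?K" and K: "parcs ?K = map_prod f f ` parcs H"
    "pverts ?K = f ` pverts H" by blast+
  define h where "h = \<lparr>iso_verts = f, iso_arcs = map_prod f f, iso_head = snd, iso_tail = fst\<rparr>"
  have "inj_on (map_prod f f) (parcs H)"
    using f(1) by (intro map_prod_inj_on[THEN inj_on_subset, of _ "pverts H" _ "pverts H"])
      (auto dest: H.in_arcsD1 H.in_arcsD2)
  then have "pre_digraph.digraph_isomorphism (with_proj H) h"
    using f(1) H.wf_digraph_axioms
    by (auto simp: pre_digraph.digraph_isomorphism_def h_def)
  moreover have "with_proj ?K = app_iso h (with_proj H)"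
    unfolding app_iso_def with_proj_def using K by (simp add: h_def)
  ultimately have "digraph_iso (with_proj H) (with_proj ?K)"
    unfolding digraph_iso_def by blast
  then have "digraph_iso (with_proj ?K) (with_proj H)"
    using H.wf_digraph_axioms by (rule digraph_iso_swap[rotated])
  then show False using free minor unfolding pivot_minor_free_def by blast
qed

section \<open>Excluding the three configurations\<close>

lemma P4_free_no_P4:
  assumes G: "pair_graph G" and free: "pivot_minor_free (path_graph 4) G"
    and e: "(a, b) \<in> parcs G" "(b, c) \<in> parcs G" "(c, d) \<in> parcs G"
  shows "(a, c) \<in> parcs G \<or> (a, d) \<in> parcs G \<or> (b, d) \<in> parcs G"
proof (rule ccontr)
  assume non: "\<not> ?thesis"
  interpret pair_graph G by fact
  have sym: "(x, y) \<in> parcs G \<longleftrightarrow> (y, x) \<in> parcs G" for x y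
    using arcs_symmetric by blast
  have irr: "(x, x) \<notin> parcs G" for x using no_loops' by auto
  have e': "(b, a) \<in> parcs G" "(c, b) \<in> parcs G" "(d, c) \<in> parcs G"
    "(a, c) \<notin> parcs G" "(c, a) \<notin> parcs G" "(a, d) \<notin> parcs G" "(d, a) \<notin> parcs G"
    "(b, d) \<notin> parcs G" "(d, b) \<notin> parcs G"
    using e non sym by blast+
  \<comment> \<open>Identifying two of the vertices would turn an edge into a loop or into one of
    the non-edges.\<close>
  have dist: "distinct [a, b, c, d]" using e e' irr by auto
  have verts: "{a, b, c, d} \<subseteq> pverts G" using e in_arcsD1 in_arcsD2 by auto
  define f where "f = (\<lambda>i. [a, b, c, d] ! i)"
  have V: "pverts (path_graph 4) = {0, 1, 2, 3}" by (auto simp: path_graph_def)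
  have A: "(i, j) \<in> parcs (path_graph 4) \<longleftrightarrow> i < 4 \<and> j < 4 \<and> (j = Suc i \<or> i = Suc j)" for i j
    by (simp add: path_graph_def)
  have f: "f 0 = a" "f (Suc 0) = b" "f 1 = b" "f 2 = c" "f 3 = d" by (simp_all add: f_def)
  show False
  proof (rule pivot_minor_freeD_embedding[OF G free pair_graph_path_graph])
    show "inj_on f (pverts (path_graph 4))"
      using dist by (auto simp: V f inj_on_def)
    show "f ` pverts (path_graph 4) \<subseteq> pverts G" using verts by (auto simp: V f)
  next
    fix i j assume "i \<in> pverts (path_graph 4)" "j \<in> pverts (path_graph 4)"
    then show "(f i, f j) \<in> parcs G \<longleftrightarrow> (i, j) \<in> parcs (path_graph 4)"
      using e e' irr unfolding V A by (elim insertE emptyE) (simp_all add: f)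
  qed
qed

text \<open>Adjacency is toggled by an exclusive or, written as inequality of truth values. This
  lets the simplifier evaluate the three complementations of a pivot.\<close>

lemma parcs_local_complement:
  "(x, y) \<in> parcs (local_complement G u) \<longleftrightarrow>
    ((x, y) \<in> parcs G) \<noteq> ((u, x) \<in> parcs G \<and> (u, y) \<in> parcs G \<and> x \<noteq> y)"
  by (auto simp: local_complement_def Let_def neighbours_def)

text \<open>Pivoting \<open>a b\<close> removes the edge \<open>c d\<close> and exchanges the
  neighbours of \<open>a\<close> and \<open>b\<close>, so the 4-cycle becomes the induced path
  \<open>c\<close>, \<open>a\<close>, \<open>b\<close>, \<open>d\<close>.\<close>

lemma P4_free_no_C4:
  assumes G: "pair_graph G" and free: "pivot_minor_free (path_graph 4) G"
    and e: "(a, b) \<in> parcs G" "(b, c) \<in> parcs G" "(c, d) \<in> parcs G" "(d, a) \<in> parcs G"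
    and neq: "a \<noteq> c" "b \<noteq> d"
  shows "(a, c) \<in> parcs G \<or> (b, d) \<in> parcs G"
proof (rule ccontr)
  assume non: "\<not> ?thesis"
  interpret pair_graph G by fact
  have sym: "(x, y) \<in> parcs G \<longleftrightarrow> (y, x) \<in> parcs G" for x y
    using arcs_symmetric by blast
  have irr: "(x, x) \<notin> parcs G" for x using no_loops' by auto
  have e': "(b, a) \<in> parcs G" "(c, b) \<in> parcs G" "(d, c) \<in> parcs G" "(a, d) \<in> parcs G"
    "(a, c) \<notin> parcs G" "(c, a) \<notin> parcs G" "(b, d) \<notin> parcs G" "(d, b) \<notin> parcs G"
    using e non sym by blast+
  have dist: "a \<noteq> b" "b \<noteq> c" "c \<noteq> d" "d \<noteq> a" using e irr by auto
  let ?H = "pivot G a b"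
  have H: "pair_graph ?H" "pivot_minor_free (path_graph 4) ?H"
    using G pivot_minor_free_trans[OF free pivot_minor_pivot[OF e(1)]]
    by (simp_all add: pair_graph_pivot)
  have "(c, a) \<in> parcs ?H" "(a, b) \<in> parcs ?H" "(b, d) \<in> parcs ?H"
    "(c, b) \<notin> parcs ?H" "(c, d) \<notin> parcs ?H" "(a, d) \<notin> parcs ?H"
    using e e' irr neq dist neq[symmetric] dist[symmetric]
    by (simp_all add: pivot_def parcs_local_complement)
  then show False using P4_free_no_P4[OF H, of c a b d] by simp
qed

text \<open>Pivoting \<open>u v\<close> toggles all pairs between the common neighbours
  \<open>a\<close>, \<open>b\<close> and the neighbours \<open>c\<close>, \<open>d\<close> of
  \<open>u\<close> alone. These pairs become edges, while \<open>a b\<close> and \<open>c d\<close>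
  stay non-edges, which gives an induced 4-cycle.\<close>

lemma P4_free_no_P3_pair_cone:
  assumes G: "pair_graph G" and free: "pivot_minor_free (path_graph 4) G"
    and u: "\<forall>x\<in>{v, a, b, c, d}. (u, x) \<in> parcs G"
    and v: "(v, a) \<in> parcs G" "(v, b) \<in> parcs G"
    and neq: "a \<noteq> b" "c \<noteq> d"
    and anti: "anticomplete (\<lambda>x y. (x, y) \<in> parcs G) {c, d} {v, a, b}"
  shows "(a, b) \<in> parcs G \<or> (c, d) \<in> parcs G"
proof (rule ccontr)
  assume non: "\<not> ?thesis"
  interpret pair_graph G by fact
  have sym: "(x, y) \<in> parcs G \<longleftrightarrow> (y, x) \<in> parcs G" for x y
    using arcs_symmetric by blast
  have irr: "(x, x) \<notin> parcs G" for x using no_loops' by auto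
  have e: "\<forall>x\<in>{v, a, b, c, d}. (u, x) \<in> parcs G \<and> (x, u) \<in> parcs G"
    "\<forall>x\<in>{a, b}. (v, x) \<in> parcs G \<and> (x, v) \<in> parcs G"
    "\<forall>x\<in>{c, d}. \<forall>y\<in>{v, a, b}. (x, y) \<notin> parcs G \<and> (y, x) \<notin> parcs G"
    "(a, b) \<notin> parcs G" "(b, a) \<notin> parcs G" "(c, d) \<notin> parcs G" "(d, c) \<notin> parcs G"
    using u v anti non sym unfolding anticomplete_def by blast+
  have dist: "u \<noteq> v" "u \<noteq> a" "u \<noteq> b" "u \<noteq> c" "u \<noteq> d" "v \<noteq> a" "v \<noteq> b"
    using e irr by auto
  have "v \<noteq> c" "v \<noteq> d" "a \<noteq> c" "a \<noteq> d" "b \<noteq> c" "b \<noteq> d" using e v by auto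
  note dist = dist this neq
  let ?H = "pivot G u v"
  have "(u, v) \<in> parcs G" using u by simp
  then have H: "pair_graph ?H" "pivot_minor_free (path_graph 4) ?H"
    using G pivot_minor_free_trans[OF free pivot_minor_pivot]
    by (simp_all add: pair_graph_pivot)
  have "(a, c) \<in> parcs ?H" "(c, b) \<in> parcs ?H" "(b, d) \<in> parcs ?H" "(d, a) \<in> parcs ?H"
    "(a, b) \<notin> parcs ?H" "(c, d) \<notin> parcs ?H"
    using e irr dist dist[symmetric]
    by (simp_all add: pivot_def parcs_local_complement)
  then show False using P4_free_no_C4[OF H, of a c b d] neq by simp
qed

lemma quasi_threshold_P4_free:
  assumes G: "pair_graph G" and free: "pivot_minor_free (path_graph 4) G"
  shows "quasi_threshold (\<lambda>x y. (x, y) \<in> parcs G)"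
proof -
  interpret pair_graph G by fact
  show ?thesis
  proof (rule quasi_threshold.intro)
    show "(y, x) \<in> parcs G" if "(x, y) \<in> parcs G" for x y
      using that arcs_symmetric by blast
    show "(x, x) \<notin> parcs G" for x using no_loops' by auto
  qed (fact P4_free_no_P4[OF assms] P4_free_no_C4[OF assms] P4_free_no_P3_pair_cone[OF assms])+
qed

section \<open>Linear rank-width\<close>

text \<open>The rows are the indicator vectors of the cut rows. The empty set gives the zero vector,
  so all rows lie in the span of at most \<open>card \<D>\<close> vectors.\<close>

lemma cutrk_le_card:
  assumes "finite \<D>" "cut_rows (\<lambda>x y. (x, y) \<in> parcs G) X (pverts G - X) \<subseteq> insert {} \<D>"
  shows "cutrk G X \<le> card \<D>"
proof -
  define ind :: "'a set \<Rightarrow> 'a \<Rightarrow> bit" where "ind D = (\<lambda>y. if y \<in> D then 1 else 0)" for D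
  have "(\<lambda>x y. if y \<in> pverts G - X then adjacency_matrix G x y else 0) ` X
    = ind ` cut_rows (\<lambda>x y. (x, y) \<in> parcs G) X (pverts G - X)"
    unfolding cut_rows_def image_image
    by (intro image_cong) (auto simp: ind_def adjacency_matrix_def)
  also have "\<dots> \<subseteq> insert 0 (ind ` \<D>)"
    using assms(2) by (auto simp: ind_def zero_fun_def)
  also have "\<dots> \<subseteq> fun_vs.span (ind ` \<D>)"
    by (intro insert_subsetI fun_vs.span_zero fun_vs.span_superset)
  finally have "cutrk G X \<le> card (ind ` \<D>)"
    unfolding cutrk_def submatrix_rank_def using assms(1) by (intro fun_vs.dim_le_card) auto
  also have "\<dots> \<le> card \<D>" using assms(1) by (rule card_image_le)
  finally show ?thesis .
qed

lemma linear_rank_width_le: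
  assumes "distinct xs" "set xs = pverts G"
    and "ordering_within (\<lambda>x y. (x, y) \<in> parcs G) k xs"
  shows "linear_rank_width G \<le> k"
proof -
  have "cutrk G (set (take i xs)) \<le> k" for i
  proof -
    have "xs = take i xs @ drop i xs" by simp
    then obtain \<D> where \<D>: "finite \<D>" "card \<D> \<le> k"
      "cut_rows (\<lambda>x y. (x, y) \<in> parcs G) (set (take i xs)) (set (drop i xs)) \<subseteq> insert {} \<D>"
      using assms(3) unfolding ordering_within_def by blast
    have "set xs = set (take i xs) \<union> set (drop i xs)"
      by (metis append_take_drop_id set_append)
    then have "set (drop i xs) = pverts G - set (take i xs)"
      using assms(1,2) set_take_disj_set_drop_if_distinct[of xs i i] by auto
    then show ?thesis using cutrk_le_card[of \<D> G "set (take i xs)"] \<D> by simp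
  qed
  then have "ordering_width G xs \<le> k" unfolding ordering_width_def by auto
  moreover have "linear_rank_width G \<le> ordering_width G xs"
    unfolding linear_rank_width_def
    using assms(1,2) by (intro Min_le finite_imageI finite_permutations_of_set imageI)
      (simp add: permutations_of_set_def)
  ultimately show ?thesis by simp
qed

theorem corollary1p7:
  fixes G :: "'a pair_pre_digraph"
  assumes "pair_graph G"
    and "pivot_minor_free (path_graph 4) G"
  shows "linear_rank_width G \<le> 3"
proof -
  interpret pair_graph G by fact
  interpret quasi_threshold "\<lambda>x y. (x, y) \<in> parcs G"
    using assms by (rule quasi_threshold_P4_free)
  obtain xs where "distinct xs" "set xs = pverts G"
    "ordering_within (\<lambda>x y. (x, y) \<in> parcs G) 2 xs"
    using ordering_within_2_exists[OF pair_finite_verts] by blast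
  \<comment> \<open>The construction attains 2, stronger than the bound 3 claimed.\<close>
  then have "linear_rank_width G \<le> 2" by (rule linear_rank_width_le)
  then show ?thesis by simp
qed

end
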